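(* Let $p>0$ and $q>1$ be integers and let $K$ be a positive integer such that $$K>\frac{p+1}{2}\,\frac{q}{q-1}-\frac{q+1}{q-1}$$ if $p$ is odd, and $$K>\left\lceil\frac{p+1}{2}\,\frac{q}{q-1}-\frac{q+1}{q-1}\right\rceil$$ if $p$ is even. Then there exists at least one compact sequence $\tilde h^p_q$ dual to $b^p_q$ with support $[-K,K]$.
   Context: The centred B-splines are defined by $\beta^0(t)=1$ for $t\in[-\tfrac12,\tfrac12)$ and $0$ otherwise, and $\beta^p=\beta^{p-1}\star\beta^0$ for $p\ge1$ (convolution on $\mathbb{R}$). The sampled B-spline sequence with integer oversampling factor $q$ is $b^p_q(k)=\beta^p(k/q)$, $k\in\mathbb{Z}$. A sequence $\tilde h:\mathbb{Z}\to\mathbb{R}$ is dual to $b^p_q$ if $$\sum_{k\in\mathbb{Z}}\tilde h(k)\,b^p_q(k-ql)=\delta_l\qquad\text{for all }l\in\mathbb{Z},$$ where $\delta_l=1$ if $l=0$ and $0$ otherwise. A sequence $w$ "has support $[-K,K]$" means $w(k)=0$ for all $|k|>K$. *)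

theory Defs
  imports "HOL-Analysis.Analysis"
begin

definition convolve :: "(real \<Rightarrow> real) \<Rightarrow> (real \<Rightarrow> real) \<Rightarrow> real \<Rightarrow> real" where
  "convolve f g t = (LINT x|lborel. f x * g (t - x))"

definition unit_box :: "real \<Rightarrow> real" where
  "unit_box = indicator {-1/2..<1/2}"

primrec bspline :: "nat \<Rightarrow> real \<Rightarrow> real" where
  "bspline 0 = unit_box"
| "bspline (Suc p) = convolve (bspline p) unit_box"

definition sampled_bspline :: "nat \<Rightarrow> int \<Rightarrow> int \<Rightarrow> real" where
  "sampled_bspline p q k = bspline p (real_of_int k / real_of_int q)"

definition dual_to :: "(int \<Rightarrow> real) \<Rightarrow> int \<Rightarrow> (int \<Rightarrow> real) \<Rightarrow> bool" where
  "dual_to h q b \<longleftrightarrow>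
     (\<forall>l. ((\<lambda>k. h k * b (k - q * l)) has_sum (if l = 0 then 1 else 0)) UNIV)"

definition compact_seq :: "(int \<Rightarrow> real) \<Rightarrow> bool" where
  "compact_seq w \<longleftrightarrow> finite {k. w k \<noteq> 0}"

text \<open>The support may be smaller than the stated interval.\<close>

definition has_support :: "(int \<Rightarrow> real) \<Rightarrow> int \<Rightarrow> bool" where
  "has_support w K \<longleftrightarrow> (\<forall>k. \<bar>k\<bar> > K \<longrightarrow> w k = 0)"

end

theory Submission
  imports Defs
begin

text \<open>
  The duality equations with \<open>\<bar>l\<bar> \<le> L = \<lceil>K/q + (p+1)/2\<rceil> - 1\<close> are the only ones that involve the
  unknowns \<open>h k\<close>, \<open>\<bar>k\<bar> \<le> K\<close>, and the hypothesis on \<open>K\<close> gives \<open>L \<le> K\<close>, so there are at least as many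
  unknowns as equations. The system is solvable because its rows are linearly independent: by the
  Schoenberg--Whitney theorem a spline \<open>\<Sum>l. c l * \<beta>\<^sup>p (x - l)\<close> that vanishes at as many increasing points
  as it has coefficients, one inside the support of each B-spline, is zero. That theorem follows from
  Rolle's argument, since each differentiation lowers the degree, adds one coefficient and adds one
  sign change, while a spline of degree 0 has fewer sign changes than coefficients.
\<close>

section \<open>B-splines with integer knots\<close>

text \<open>The shift puts the knots at integers for every \<open>p\<close>; the centred B-splines
  have half-integer knots when \<open>p\<close> is even.\<close>

definition causal_bspline :: "nat \<Rightarrow> real \<Rightarrow> real" where
  "causal_bspline p x = bspline p (x - (real p + 1) / 2)"

lemma causal_bspline_0: "causal_bspline 0 x = indicator {0..<1} x"
  by (auto simp: causal_bspline_def unit_box_def indicator_def)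

lemma convolve_unit_box:
  assumes "\<And>a b. set_integrable lborel {a..b} f"
  shows "convolve f unit_box t = integral {t - 1/2..t + 1/2} f"
proof -
  \<comment> \<open>The reflected box \<open>unit_box (t - x)\<close> lives, as a function of
    \<open>x\<close>, on an interval open on the left; the missing endpoint is negligible.\<close>
  have int: "set_integrable lborel {t - 1/2<..t + 1/2} f"
    by (rule set_integrable_subset[OF assms[of "t - 1/2" "t + 1/2"]]) auto
  have "convolve f unit_box t = set_lebesgue_integral lborel {t - 1/2<..t + 1/2} f"
    unfolding convolve_def set_lebesgue_integral_def unit_box_def
    by (rule Bochner_Integration.integral_cong) (auto simp: indicator_def)
  also have "\<dots> = integral {t - 1/2<..t + 1/2} f"
    using int by (rule set_borel_integral_eq_integral)
  also have "\<dots> = integral {t - 1/2..t + 1/2} f"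
    by (rule integral_subset_negligible)
      (auto intro: negligible_subset[of "{t - 1/2}"])
  finally show ?thesis .
qed

text \<open>The three claims feed each other: integrability in degree \<open>p\<close> turns the
  convolution into a window integral, this integral is continuous in \<open>x\<close>, and
  continuity gives integrability in degree \<open>p + 1\<close>. Each is therefore first derived
  from integrability, and the induction closes the circle.\<close>

lemma shows set_integrable_causal_bspline: "set_integrable lborel {a..b} (causal_bspline p)"
  and causal_bspline_Suc: "causal_bspline (Suc p) x = integral {x - 1..x} (causal_bspline p)"
  and continuous_on_causal_bspline_Suc: "continuous_on A (causal_bspline (Suc p))"
proof -
  have bint: "set_integrable lborel {a..b} (bspline p)"
    if "\<And>a b. set_integrable lborel {a..b} (causal_bspline p)" for p a b
  proof -
    let ?s = "(real p + 1) / 2"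
    have "integrable lborel (\<lambda>x. indicator {a + ?s..b + ?s} (?s + 1 * x) *\<^sub>R causal_bspline p (?s + 1 * x))"
      using that[of "a + ?s" "b + ?s"] unfolding set_integrable_def
      by (intro lborel_integrable_real_affine) auto
    moreover have "indicator {a + ?s..b + ?s} (?s + 1 * x) *\<^sub>R causal_bspline p (?s + 1 * x)
        = indicator {a..b} x *\<^sub>R bspline p x" for x
      by (auto simp: causal_bspline_def indicator_def)
    ultimately show ?thesis unfolding set_integrable_def by simp
  qed
  have Suc: "causal_bspline (Suc p) x = integral {x - 1..x} (causal_bspline p)"
    if i: "\<And>a b. set_integrable lborel {a..b} (causal_bspline p)" for p x
  proof -
    let ?s = "(real p + 1) / 2"
    have "causal_bspline (Suc p) x
        = integral {x - (real (Suc p) + 1)/2 - 1/2..x - (real (Suc p) + 1)/2 + 1/2} (bspline p)"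
      unfolding causal_bspline_def by (simp add: convolve_unit_box[OF bint[OF i]])
    also have "\<dots> = integral {x - 1 - ?s..x - ?s} (bspline p)"
      by (rule arg_cong2[where f = integral]) (auto simp: field_simps)
    also have "\<dots> = integral {x - 1..x} (\<lambda>x. bspline p (x - ?s))"
      using integral_shift_real_ivl[of "x - 1" ?s x "\<lambda>x. bspline p (x - ?s)"] by simp
    finally show ?thesis unfolding causal_bspline_def .
  qed
  have cont: "continuous_on A (causal_bspline (Suc p))"
    if i: "\<And>a b. set_integrable lborel {a..b} (causal_bspline p)" for p A
  proof -
    have hk: "causal_bspline p integrable_on {a..b}" for a b
      using i[of a b] by (rule set_borel_integral_eq_integral)
    have "isCont (causal_bspline (Suc p)) x" for x
    proof -
      \<comment> \<open>The base point \<open>x - 3\<close> lies left of every \<open>u - 1\<close>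
        used below, so the window integral is a difference of two values of one indefinite
        integral.\<close>
      let ?G = "\<lambda>u. integral {x - 3..u} (causal_bspline p)"
      have G: "continuous_on {x - 3..x + 3} ?G"
        by (rule indefinite_integral_continuous_1) (rule hk)
      have "continuous_on {x - 1..x + 1} (\<lambda>u. ?G u - ?G (u - 1))"
        by (intro continuous_intros continuous_on_subset[OF G] continuous_on_compose2[OF G]) auto
      moreover have "causal_bspline (Suc p) u = ?G u - ?G (u - 1)" if "u \<in> {x - 1..x + 1}" for u
        unfolding Suc[OF i]
        using Henstock_Kurzweil_Integration.integral_combine[of "x - 3" "u - 1" u "causal_bspline p"] that hk by auto
      ultimately have "continuous_on {x - 1..x + 1} (causal_bspline (Suc p))"
        by (metis (no_types, lifting) continuous_on_cong)
      then show ?thesis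
        by (rule continuous_on_interior) auto
    qed
    then show ?thesis by (simp add: continuous_at_imp_continuous_on)
  qed
  have int: "set_integrable lborel {a..b} (causal_bspline p)" for p a b
  proof (induction p arbitrary: a b)
    case 0
    have "set_integrable lborel {a..b} (indicator {0..<1::real} :: real \<Rightarrow> real)"
      unfolding set_integrable_def
      by (rule integrableI_bounded_set_indicator[where B = 1])
        (auto simp: indicator_def emeasure_lborel_Icc_eq)
    moreover have "causal_bspline 0 = indicator {0..<1}"
      by (rule ext) (simp add: causal_bspline_0)
    ultimately show ?case by simp
  next
    case (Suc p)
    show ?case
      using borel_integrable_atLeastAtMost'[OF cont[OF Suc]] .
  qed
  show "set_integrable lborel {a..b} (causal_bspline p)" by (rule int)
  show "causal_bspline (Suc p) x = integral {x - 1..x} (causal_bspline p)" by (rule Suc[OF int])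
  show "continuous_on A (causal_bspline (Suc p))" by (rule cont[OF int])
qed

lemma causal_bspline_integrable: "causal_bspline p integrable_on {a..b}"
  using set_integrable_causal_bspline by (rule set_borel_integral_eq_integral)

lemma causal_bspline_shift_integrable:
  "(\<lambda>x. causal_bspline p (x - c)) integrable_on {a..b}"
  using integrable_shift_real_ivl[of "causal_bspline p" "a - c" "b - c" "- c"] causal_bspline_integrable
  by (simp add: algebra_simps)

text \<open>Degree 0 jumps at the knots, so open cells are the sets on which continuity holds in
  every degree.\<close>

lemma continuous_on_causal_bspline:
  "continuous_on {of_int i<..<of_int i + 1} (causal_bspline p)"
proof (cases p)
  case 0
  have "causal_bspline 0 x = (if i = 0 then 1 else 0)" if "x \<in> {of_int i<..<of_int i + 1}" for x
  proof -
    have "\<lfloor>x\<rfloor> = i" using that by (simp add: floor_unique)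
    moreover have "x \<in> {0..<1} \<longleftrightarrow> \<lfloor>x\<rfloor> = 0" by (auto simp: floor_eq_iff)
    ultimately show ?thesis by (simp add: causal_bspline_0 indicator_def)
  qed
  then show ?thesis
    unfolding 0 by (metis (no_types, lifting) continuous_on_cong continuous_on_const)
qed (simp add: continuous_on_causal_bspline_Suc)

lemma causal_bspline_eq_0: "x < 0 \<or> x \<ge> real p + 1 \<Longrightarrow> causal_bspline p x = 0"
proof (induction p arbitrary: x)
  case 0
  then show ?case by (auto simp: causal_bspline_0)
next
  case (Suc p)
  then have "integral {x - 1..x} (causal_bspline p) = integral {x - 1..x} (\<lambda>_. 0 :: real)"
    by (intro integral_cong) auto
  then show ?case by (simp add: causal_bspline_Suc)
qed

lemma causal_bspline_Suc_at_0: "causal_bspline (Suc p) 0 = 0"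
proof -
  have "integral {-1..0} (causal_bspline p) = integral {-1..0 :: real} (\<lambda>_. 0 :: real)"
    by (rule integral_spike[of "{0 :: real}"]) (auto simp: causal_bspline_eq_0)
  then show ?thesis by (simp add: causal_bspline_Suc)
qed

lemma integral_unit_intervals:
  fixes f :: "real \<Rightarrow> real"
  assumes "\<And>a b. f integrable_on {a..b}"
  shows "(\<Sum>m<n. integral {x + real m..x + real m + 1} f) = integral {x..x + real n} f"
proof (induction n)
  case (Suc n)
  then show ?case
    using Henstock_Kurzweil_Integration.integral_combine[of x "x + real n" "x + real n + 1" f] assms
    by (simp add: add_ac)
qed simp

text \<open>In degree \<open>p + 1\<close> the unit windows of the summands join up to an interval
  containing the support of the degree \<open>p\<close> B-spline, so the sum is the full integral of
  the latter. Folding this integral back onto \<open>0..1\<close> leaves the integral of the degree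
  \<open>p\<close> sum, which is 1.\<close>

lemma causal_bspline_partition_of_unity:
  "0 \<le> u \<Longrightarrow> u < 1 \<Longrightarrow> (\<Sum>m\<le>p. causal_bspline p (u + real m)) = 1"
proof (induction p arbitrary: u)
  case 0
  then show ?case by (simp add: causal_bspline_0)
next
  case (Suc p)
  let ?f = "causal_bspline p"
  have "(\<Sum>m\<le>Suc p. causal_bspline (Suc p) (u + real m))
      = (\<Sum>m<Suc (Suc p). integral {u - 1 + real m..u - 1 + real m + 1} ?f)"
    unfolding lessThan_Suc_atMost by (simp add: causal_bspline_Suc algebra_simps)
  also have "\<dots> = integral {u - 1..u + real p + 1} ?f"
    by (subst integral_unit_intervals) (auto simp: causal_bspline_integrable algebra_simps)
  also have "\<dots> = integral {0..real p + 1} ?f"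
  proof -
    have "integral {u - 1..u + real p + 1} ?f = integral {u - 1..0} ?f + integral {0..real p + 1} ?f
        + integral {real p + 1..u + real p + 1} ?f"
      using Suc.prems causal_bspline_integrable[of p]
        Henstock_Kurzweil_Integration.integral_combine[of "u - 1" 0 "real p + 1" ?f]
        Henstock_Kurzweil_Integration.integral_combine[of "u - 1" "real p + 1" "u + real p + 1" ?f]
      by simp
    moreover have "integral {u - 1..0} ?f = integral {u - 1..0} (\<lambda>_. 0 :: real)"
      by (rule integral_spike[of "{0 :: real}"]) (auto simp: causal_bspline_eq_0)
    moreover have "integral {real p + 1..u + real p + 1} ?f
        = integral {real p + 1..u + real p + 1} (\<lambda>_. 0 :: real)"
      by (rule integral_cong) (simp add: causal_bspline_eq_0)
    ultimately show ?thesis by simp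
  qed
  also have "\<dots> = (\<Sum>m<Suc p. integral {0 + real m..0 + real m + 1} ?f)"
    by (subst integral_unit_intervals) (auto simp: causal_bspline_integrable algebra_simps)
  also have "\<dots> = (\<Sum>m\<le>p. integral {0..1} (\<lambda>v. ?f (v + real m)))"
    unfolding lessThan_Suc_atMost
  proof (rule sum.cong)
    fix m
    show "integral {0 + real m..0 + real m + 1} ?f = integral {0..1} (\<lambda>v. ?f (v + real m))"
      using integral_shift_real_ivl[of "real m" "real m" "real m + 1" ?f] by simp
  qed simp
  also have "\<dots> = integral {0..1} (\<lambda>v. \<Sum>m\<le>p. ?f (v + real m))"
    using causal_bspline_shift_integrable[of p "- real _" 0 1]
    by (intro Henstock_Kurzweil_Integration.integral_sum[symmetric]) auto
  also have "\<dots> = integral {0..1 :: real} (\<lambda>_. 1 :: real)"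
    by (rule integral_spike[of "{1 :: real}"]) (auto simp: Suc.IH)
  finally show ?case by simp
qed

section \<open>Splines, their derivatives and local linear independence\<close>

text \<open>Coefficients are indexed by all integers; where differences
  \<open>c l - c (l - 1)\<close> occur, \<open>c\<close> is assumed to vanish off
  \<open>a..b\<close>, which avoids boundary cases.\<close>

definition spline :: "nat \<Rightarrow> (int \<Rightarrow> real) \<Rightarrow> int \<Rightarrow> int \<Rightarrow> real \<Rightarrow> real" where
  "spline p c a b x = (\<Sum>l=a..b. c l * causal_bspline p (x - of_int l))"

lemma spline_local:
  assumes "\<And>l. l \<notin> {a..b} \<Longrightarrow> c l = 0" "of_int i \<le> u" "u < of_int i + 1"
  shows "spline p c a b u = (\<Sum>l=i - int p..i. c l * causal_bspline p (u - of_int l))"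
proof -
  let ?g = "\<lambda>l. c l * causal_bspline p (u - of_int l)"
  have "causal_bspline p (u - of_int l) = 0" if "l \<notin> {i - int p..i}" for l
  proof (rule causal_bspline_eq_0)
    from that have "l \<ge> i + 1 \<or> l \<le> i - int p - 1" by auto
    then have "(of_int l :: real) \<ge> of_int (i + 1) \<or> (of_int l :: real) \<le> of_int (i - int p - 1)"
      by (simp only: of_int_le_iff)
    then show "u - of_int l < 0 \<or> u - of_int l \<ge> real p + 1" using assms by auto
  qed
  then have "sum ?g {i - int p..i} = sum ?g ({a..b} \<union> {i - int p..i})"
    by (intro sum.mono_neutral_left) auto
  also have "\<dots> = sum ?g {a..b}"
    using assms(1) by (intro sum.mono_neutral_right) auto
  finally show ?thesis by (simp add: spline_def)
qed

lemma spline_eq_0_outside: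
  assumes "u < of_int a \<or> u \<ge> of_int b + real p + 1"
  shows "spline p c a b u = 0"
  unfolding spline_def
proof (intro sum.neutral ballI)
  fix l assume "l \<in> {a..b}"
  then have "(of_int a :: real) \<le> of_int l" "(of_int l :: real) \<le> of_int b" by auto
  then have "causal_bspline p (u - of_int l) = 0"
    using assms by (intro causal_bspline_eq_0) auto
  then show "c l * causal_bspline p (u - of_int l) = 0" by simp
qed

lemma spline_integrable: "spline p c a b integrable_on {x..y}"
  unfolding spline_def
  by (intro integrable_sum integrable_on_mult_right causal_bspline_shift_integrable) auto

text \<open>The integrated form of the rule that the derivative of a B-spline is the backward
  difference of the B-spline one degree lower. Integration avoids the kinks of degree 1.\<close>

lemma causal_bspline_Suc_diff:
  assumes "x \<le> y"
  shows "causal_bspline (Suc p) y - causal_bspline (Suc p) x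
    = integral {x..y} (causal_bspline p) - integral {x..y} (\<lambda>u. causal_bspline p (u - 1))"
proof -
  have "integral {x - 1..x} (causal_bspline p) + integral {x..y} (causal_bspline p)
      = integral {x - 1..y - 1} (causal_bspline p) + integral {y - 1..y} (causal_bspline p)"
    using assms causal_bspline_integrable
    by (simp add: Henstock_Kurzweil_Integration.integral_combine)
  moreover have "integral {x - 1..y - 1} (causal_bspline p)
      = integral {x..y} (\<lambda>u. causal_bspline p (u - 1))"
    using integral_shift_real_ivl[of x 1 y "\<lambda>u. causal_bspline p (u - 1)"] by simp
  ultimately show ?thesis by (simp add: causal_bspline_Suc)
qed

text \<open>Summation by parts moves the shift from the B-splines to the coefficients. The last
  shifted B-spline starts at \<open>b + 1\<close>, so the derivative has one coefficient
  more.\<close>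

lemma spline_Suc_diff:
  assumes c: "\<And>l. l \<notin> {a..b} \<Longrightarrow> c l = 0" and "x \<le> y"
  shows "spline (Suc p) c a b y - spline (Suc p) c a b x
    = integral {x..y} (spline p (\<lambda>l. c l - c (l - 1)) a (b + 1))"
proof -
  let ?I = "\<lambda>l. integral {x..y} (\<lambda>u. causal_bspline p (u - of_int l))"
  have "causal_bspline (Suc p) (y - of_int l) - causal_bspline (Suc p) (x - of_int l)
      = ?I l - ?I (l + 1)" for l
  proof -
    have "integral {x - of_int l..y - of_int l} (\<lambda>u. causal_bspline p (u - d))
        = integral {x..y} (\<lambda>u. causal_bspline p (u - of_int l - d))" for d
      using integral_shift_real_ivl[of x "of_int l" y "\<lambda>u. causal_bspline p (u - of_int l - d)"]
      by simp
    from this[of 0] this[of 1] causal_bspline_Suc_diff[of "x - of_int l" "y - of_int l" p] assms(2)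
    show ?thesis by (simp add: diff_diff_add)
  qed
  then have "spline (Suc p) c a b y - spline (Suc p) c a b x
      = (\<Sum>l=a..b. c l * ?I l) - (\<Sum>l=a..b. c l * ?I (l + 1))"
    by (simp add: spline_def flip: sum_subtractf right_diff_distrib)
  also have "(\<Sum>l=a..b. c l * ?I (l + 1)) = (\<Sum>l=a + 1..b + 1. c (l - 1) * ?I l)"
    by (rule sum.reindex_bij_witness[of _ "\<lambda>l. l - 1" "\<lambda>l. l + 1"]) auto
  also have "\<dots> = (\<Sum>l=a..b + 1. c (l - 1) * ?I l)"
    using c by (intro sum.mono_neutral_left) auto
  also have "(\<Sum>l=a..b. c l * ?I l) = (\<Sum>l=a..b + 1. c l * ?I l)"
    using c by (intro sum.mono_neutral_left) auto
  also have "(\<Sum>l=a..b + 1. c l * ?I l) - (\<Sum>l=a..b + 1. c (l - 1) * ?I l)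
      = (\<Sum>l=a..b + 1. integral {x..y} (\<lambda>u. (c l - c (l - 1)) * causal_bspline p (u - of_int l)))"
    by (simp flip: sum_subtractf left_diff_distrib)
  also have "\<dots> = integral {x..y} (spline p (\<lambda>l. c l - c (l - 1)) a (b + 1))"
    unfolding spline_def
    by (intro Henstock_Kurzweil_Integration.integral_sum[symmetric] integrable_on_mult_right
        causal_bspline_shift_integrable) auto
  finally show ?thesis .
qed

lemma continuous_on_spline:
  "continuous_on {of_int i<..<of_int i + 1} (spline p c a b)"
  unfolding spline_def
proof (intro continuous_intros)
  fix l
  show "continuous_on {of_int i<..<of_int i + 1} (\<lambda>x. causal_bspline p (x - of_int l))"
    by (rule continuous_on_compose2[OF continuous_on_causal_bspline[of "i - l"]])
      (auto intro!: continuous_intros)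
qed

text \<open>Induction on the degree: the derivative also vanishes on the interval, so the active
  coefficients are all equal, and by the partition of unity their common value is the value of the
  spline, which is 0.\<close>

lemma spline_coeffs_eq_0:
  assumes "\<And>l. l \<notin> {a..b} \<Longrightarrow> c l = 0" "of_int i \<le> x" "x < y" "y \<le> of_int i + 1"
    and "\<And>u. x < u \<Longrightarrow> u < y \<Longrightarrow> spline p c a b u = 0"
    and "l \<in> {i - int p..i}"
  shows "c l = 0"
  using assms
proof (induction p arbitrary: c b l)
  case 0
  have "spline 0 c a b ((x + y) / 2) = c i * causal_bspline 0 ((x + y) / 2 - of_int i)"
    using 0 by (subst spline_local[of _ _ _ i]) auto
  also have "\<dots> = c i" using 0 by (simp add: causal_bspline_0 field_simps)
  finally show ?case using 0 by simp
next
  case (Suc p)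
  let ?c' = "\<lambda>l. c l - c (l - 1)"
  let ?s' = "spline p ?c' a (b + 1)"
  have s': "?s' u = 0" if u: "x < u" "u < y" for u
  proof -
    \<comment> \<open>The closed interval \<open>v..w\<close> stays inside the open cell, where
      \<open>?s'\<close> is continuous even for \<open>p = 0\<close>; its integral from
      \<open>v\<close> is constantly 0 there.\<close>
    define v w where "v = (x + u) / 2" and "w = (u + y) / 2"
    have vw: "x < v" "v < u" "u < w" "w < y" using u by (auto simp: v_def w_def)
    have cont: "continuous_on {v..w} ?s'"
      using Suc.prems vw by (intro continuous_on_subset[OF continuous_on_spline[of i]]) auto
    have zero: "integral {v..z} ?s' = 0" if "z \<in> {v..w}" for z
      using spline_Suc_diff[where c = c and a = a and b = b and p = p and x = v and y = z, OF Suc.prems(1)] Suc.prems(5) that vw by simp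
    have "((\<lambda>z. integral {v..z} ?s') has_vector_derivative ?s' u) (at u within {v..w})"
      using cont vw by (intro integral_has_vector_derivative) auto
    then have "((\<lambda>_. 0) has_vector_derivative ?s' u) (at u within {v..w})"
      using zero vw by (elim has_vector_derivative_transform[rotated 2]) auto
    moreover have "((\<lambda>_. 0 :: real) has_vector_derivative 0) (at u within {v..w})"
      by (rule has_vector_derivative_const)
    ultimately show ?thesis
      using vector_derivative_unique_within_closed_interval[of v w u "\<lambda>_. 0" "?s' u" 0] vw by simp
  qed
  have c': "?c' l = 0" if "l \<in> {i - int p..i}" for l
    by (rule Suc.IH[where b = "b + 1"]) (use Suc.prems s' that in auto)
  \<comment> \<open>The \<open>p + 1\<close> vanishing differences link all \<open>p + 2\<close>
    coefficients active on the cell.\<close>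
  have const: "c (i - int m) = c i" if "m \<le> Suc p" for m
    using that
  proof (induction m)
    case (Suc m)
    then show ?case using c'[of "i - int m"] by (simp add: algebra_simps)
  qed simp
  then have const': "c l' = c i" if "l' \<in> {i - int (Suc p)..i}" for l'
    using that const[of "nat (i - l')"] by auto
  define u where "u = (x + y) / 2"
  have u: "of_int i \<le> u" "u < of_int i + 1" using Suc.prems by (auto simp: u_def)
  have "spline (Suc p) c a b u
      = (\<Sum>l=i - int (Suc p)..i. c l * causal_bspline (Suc p) (u - of_int l))"
    using Suc.prems(1) u by (intro spline_local) auto
  also have "\<dots> = (\<Sum>l=i - int (Suc p)..i. c i * causal_bspline (Suc p) (u - of_int l))"
    by (intro sum.cong refl) (simp only: const')
  also have "\<dots> = (\<Sum>m\<le>Suc p. c i * causal_bspline (Suc p) (u - of_int i + real m))"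
    by (rule sum.reindex_bij_witness[of _ "\<lambda>m. i - int m" "\<lambda>l. nat (i - l)"]) auto
  also have "\<dots> = c i"
    using causal_bspline_partition_of_unity[of "u - of_int i" "Suc p"] u
    by (simp flip: sum_distrib_left del: sum.atMost_Suc)
  finally have "c i = 0" using Suc.prems by (simp add: u_def)
  with const[of "nat (i - l)"] Suc.prems show ?case by auto
qed

section \<open>Sign changes of splines\<close>

text \<open>\<open>alternates f n \<sigma> t\<close>: some \<open>t\<^sub>0 < \<dots> < t\<^sub>n = t\<close> carry values of \<open>f\<close> of alternating strict
  sign, the last one having the sign of \<open>\<sigma>\<close>.\<close>

inductive alternates :: "(real \<Rightarrow> real) \<Rightarrow> nat \<Rightarrow> real \<Rightarrow> real \<Rightarrow> bool" for f where
  alternates_0: "\<sigma> * f t > 0 \<Longrightarrow> alternates f 0 \<sigma> t"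
| alternates_Suc: "alternates f n \<sigma> s \<Longrightarrow> s < t \<Longrightarrow> - \<sigma> * f t > 0 \<Longrightarrow> alternates f (Suc n) (- \<sigma>) t"

lemma alternates_last: "alternates f n \<sigma> t \<Longrightarrow> \<sigma> * f t > 0"
  by (induction rule: alternates.induct) auto

text \<open>A substitute for the mean value theorem that needs no derivative at the knots: a
  nonpositive integrand cannot produce an increase. The factor \<open>\<sigma>\<close> covers
  decreases as well.\<close>

lemma spline_Suc_increase:
  assumes "\<And>l. l \<notin> {a..b} \<Longrightarrow> c l = 0" "x < y"
    and "\<sigma> * spline (Suc p) c a b x < \<sigma> * spline (Suc p) c a b y"
  obtains u where "x < u" "u < y" "\<sigma> * spline p (\<lambda>l. c l - c (l - 1)) a (b + 1) u > 0"
proof (rule ccontr)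
  let ?s' = "spline p (\<lambda>l. c l - c (l - 1)) a (b + 1)"
  assume "\<not> thesis"
  with that have neg: "\<sigma> * ?s' u \<le> 0" if "u \<in> {x<..<y}" for u
    using that by force
  have "integral {x<..<y} (\<lambda>u. \<sigma> * ?s' u) \<le> integral {x<..<y} (\<lambda>_. 0)"
    using neg spline_integrable[of p "\<lambda>l. c l - c (l - 1)" a "b + 1" x y]
    by (intro integral_le)
      (auto simp only: integrable_on_open_interval_real intro!: integrable_on_mult_right)
  then have "\<sigma> * integral {x..y} ?s' \<le> 0"
    by (simp add: integral_open_interval_real)
  moreover have "integral {x..y} ?s' = spline (Suc p) c a b y - spline (Suc p) c a b x"
    using assms(2) by (intro spline_Suc_diff[symmetric]) (simp_all add: assms(1))
  ultimately show False using assms(3) by (simp add: right_diff_distrib)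
qed

text \<open>Rolle's argument: the spline is 0 on both sides of its support, so the derivative takes
  a sign before the first alternation point, between consecutive ones and after the last, one point
  more in all.\<close>

lemma alternates_derivative:
  assumes c: "\<And>l. l \<notin> {a..b} \<Longrightarrow> c l = 0" and "alternates (spline (Suc p) c a b) n \<sigma> t"
  shows "\<exists>\<tau> u. alternates (spline p (\<lambda>l. c l - c (l - 1)) a (b + 1)) (Suc n) \<tau> u"
proof -
  let ?s = "spline (Suc p) c a b"
  let ?s' = "spline p (\<lambda>l. c l - c (l - 1)) a (b + 1)"
  \<comment> \<open>Each alternation point is preceded by a derivative value of the same sign: the
    first because the spline leaves 0, the others because it crosses over from the opposite
    sign.\<close>
  have "\<exists>u<t. alternates ?s' n \<sigma> u"
    using assms(2)
  proof (induction rule: alternates.induct)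
    case (alternates_0 \<sigma> t)
    define x where "x = min t (of_int a) - 1"
    have x: "x < t" "?s x = 0" by (auto simp: x_def intro!: spline_eq_0_outside)
    obtain u where "u < t" "\<sigma> * ?s' u > 0"
      using spline_Suc_increase[where c = c and a = a and b = b and \<sigma> = \<sigma> and p = p, OF c x(1)] alternates_0 x(2) by auto
    then show ?case using alternates.alternates_0 by blast
  next
    case (alternates_Suc n \<sigma> s t)
    then obtain u where u: "u < s" "alternates ?s' n \<sigma> u" by blast
    have "\<sigma> * ?s s > 0" using alternates_Suc.hyps(1) by (rule alternates_last)
    then obtain v where "s < v" "v < t" "- \<sigma> * ?s' v > 0"
      using spline_Suc_increase[where c = c and a = a and b = b and \<sigma> = "- \<sigma>" and p = p, OF c alternates_Suc.hyps(2)] alternates_Suc.hyps(3)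
      by auto
    with u show ?case by (meson alternates.alternates_Suc order_less_trans)
  qed
  then obtain u where u: "u < t" "alternates ?s' n \<sigma> u" by blast
  \<comment> \<open>Right of the support, the return to 0 after \<open>t\<close> gives the extra
    sign.\<close>
  define y where "y = max t (of_int b + real (Suc p) + 1) + 1"
  have y: "t < y" "?s y = 0" by (auto simp: y_def intro!: spline_eq_0_outside)
  obtain v where "t < v" "- \<sigma> * ?s' v > 0"
    using spline_Suc_increase[where c = c and a = a and b = b and \<sigma> = "- \<sigma>" and p = p, OF c y(1)] alternates_last[OF assms(2)] y(2) by auto
  with u show ?thesis by (meson alternates.alternates_Suc order_less_trans)
qed

text \<open>The inequality says that coefficients outnumber sign changes. The derivative raises both
  counts by one, which reduces the claim to step functions, where alternating points lie in
  different cells.\<close>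

lemma spline_variation_diminishing:
  assumes "\<And>l. l \<notin> {a..b} \<Longrightarrow> c l = 0" "alternates (spline p c a b) n \<sigma> t"
  shows "a + int n \<le> b"
  using assms
proof (induction p arbitrary: c b n \<sigma> t)
  case 0
  have s: "spline 0 c a b u = c \<lfloor>u\<rfloor>" for u
  proof -
    have "of_int \<lfloor>u\<rfloor> \<le> u" "u < of_int \<lfloor>u\<rfloor> + 1" by linarith+
    then have "spline 0 c a b u = c \<lfloor>u\<rfloor> * causal_bspline 0 (u - of_int \<lfloor>u\<rfloor>)"
      using spline_local[OF 0(1), where p = 0 and i = "\<lfloor>u\<rfloor>" and u = u] by simp
    then show ?thesis by (simp add: causal_bspline_0 indicator_def) linarith
  qed
  from 0(2) have "a + int n \<le> \<lfloor>t\<rfloor>"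
  proof (induction rule: alternates.induct)
    case (alternates_0 \<sigma> t)
    then have "c \<lfloor>t\<rfloor> \<noteq> 0" by (auto simp: s)
    then show ?case using 0(1) by force
  next
    case (alternates_Suc n \<sigma> u t)
    have "\<lfloor>u\<rfloor> \<noteq> \<lfloor>t\<rfloor>"
      using alternates_last[OF alternates_Suc.hyps(1)] alternates_Suc.hyps(3) by (auto simp: s)
    moreover have "\<lfloor>u\<rfloor> \<le> \<lfloor>t\<rfloor>" using alternates_Suc.hyps(2) by (simp add: floor_mono)
    ultimately show ?case using alternates_Suc.IH by simp
  qed
  moreover have "c \<lfloor>t\<rfloor> \<noteq> 0" using alternates_last[OF 0(2)] by (auto simp: s)
  then have "\<lfloor>t\<rfloor> \<le> b" using 0(1) by force
  ultimately show ?case by simp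
next
  case (Suc p)
  obtain \<tau> u where "alternates (spline p (\<lambda>l. c l - c (l - 1)) a (b + 1)) (Suc n) \<tau> u"
    using alternates_derivative[OF Suc.prems] by blast
  then have "a + int (Suc n) \<le> b + 1"
    by (rule Suc.IH[rotated]) (use Suc.prems(1) in auto)
  then show ?case by simp
qed

section \<open>The Schoenberg-Whitney theorem\<close>

text \<open>In positive degree the left end of the support is a zero too, so both ends can serve as
  extra zeros in the Rolle count.\<close>

lemma spline_Suc_eq_0:
  assumes "u \<le> of_int a \<or> u \<ge> of_int b + real p + 2"
  shows "spline (Suc p) c a b u = 0"
proof (cases "u = of_int a")
  case True
  have "causal_bspline (Suc p) (of_int a - of_int l) = 0" if "l \<in> {a..b}" for l
    using that by (cases "l = a") (auto simp: causal_bspline_Suc_at_0 intro!: causal_bspline_eq_0)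
  then show ?thesis unfolding spline_def True by (intro sum.neutral) simp
next
  case False
  with assms show ?thesis by (intro spline_eq_0_outside) auto
qed

text \<open>In each of the \<open>b - a + 2\<close> gaps between the zeros the derivative takes both
  signs, so each gap adds an alternation. The derivative has only the \<open>b - a + 2\<close>
  coefficients \<open>a..b + 1\<close>, too few for that many sign changes.\<close>

lemma spline_nonzero_gaps:
  fixes X :: "int \<Rightarrow> real"
  assumes c: "\<And>l. l \<notin> {a..b} \<Longrightarrow> c l = 0" and "a \<le> b"
    and X0: "\<And>j. j \<in> {a - 1..b + 1} \<Longrightarrow> spline (Suc p) c a b (X j) = 0"
    and gap: "\<And>j. j \<in> {a - 1..b} \<Longrightarrow>
      \<exists>u. X j < u \<and> u < X (j + 1) \<and> spline (Suc p) c a b u \<noteq> 0"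
  shows False
proof -
  let ?s = "spline (Suc p) c a b"
  let ?s' = "spline p (\<lambda>l. c l - c (l - 1)) a (b + 1)"
  have increase: "\<exists>u. x < u \<and> u < y \<and> \<sigma> * ?s' u > 0" if "x < y" "\<sigma> * ?s x < \<sigma> * ?s y" for x y \<sigma>
    by (rule spline_Suc_increase[of a b c x y \<sigma> p]) (use c that in auto)
  have "\<exists>\<sigma> t. t < X (a + int m) \<and> alternates ?s' (Suc m) \<sigma> t" if "a + int m \<le> b + 1" for m
    using that
  proof (induction m)
    case 0
    obtain y where y: "X (a - 1) < y" "y < X a" "?s y \<noteq> 0"
      using gap[of "a - 1"] \<open>a \<le> b\<close> by auto
    define \<sigma> where "\<sigma> = sgn (?s y)"
    have \<sigma>: "\<sigma> * ?s y > 0" using y(3) by (auto simp: \<sigma>_def sgn_if)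
    obtain u where u: "u < y" "\<sigma> * ?s' u > 0"
      using increase[OF y(1), of \<sigma>] \<sigma> X0[of "a - 1"] \<open>a \<le> b\<close> by auto
    obtain v where v: "y < v" "v < X a" "- \<sigma> * ?s' v > 0"
      using increase[OF y(2), of "- \<sigma>"] \<sigma> X0[of a] \<open>a \<le> b\<close> by auto
    have "alternates ?s' (Suc 0) (- \<sigma>) v"
      using u v by (intro alternates_Suc[of _ _ _ u] alternates_0) auto
    with v(2) show ?case by auto
  next
    case (Suc m)
    let ?j = "a + int m"
    obtain \<sigma> t where t: "t < X ?j" "alternates ?s' (Suc m) \<sigma> t"
      using Suc by auto
    obtain y where y: "X ?j < y" "y < X (?j + 1)" "?s y \<noteq> 0"
      using gap[of ?j] Suc.prems by auto
    have "\<sigma> \<noteq> 0" using alternates_last[OF t(2)] by auto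
    \<comment> \<open>The sign of \<open>?s y\<close> decides whether the required sign
      \<open>- \<sigma>\<close> of the derivative occurs on the way from 0 to \<open>?s y\<close> or
      on the way back.\<close>
    with y(3) consider "- \<sigma> * ?s y > 0" | "- \<sigma> * ?s y < 0"
      by (metis linorder_less_linear mult_eq_0_iff neg_equal_0_iff_equal)
    then obtain v where v: "X ?j < v" "v < X (?j + 1)" "- \<sigma> * ?s' v > 0"
    proof cases
      case 1
      moreover have "?s (X ?j) = 0" using X0 Suc.prems by simp
      ultimately obtain v where "X ?j < v" "v < y" "- \<sigma> * ?s' v > 0"
        using increase[OF y(1), of "- \<sigma>"] by auto
      with y(2) show ?thesis by (intro that[of v]) auto
    next
      case 2
      moreover have "?s (X (?j + 1)) = 0" using X0 Suc.prems by simp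
      ultimately obtain v where "y < v" "v < X (?j + 1)" "- \<sigma> * ?s' v > 0"
        using increase[OF y(2), of "- \<sigma>"] by auto
      with y(1) show ?thesis by (intro that[of v]) auto
    qed
    then have "alternates ?s' (Suc (Suc m)) (- \<sigma>) v"
      using t by (intro alternates_Suc[of _ _ _ t]) auto
    with v(2) show ?case by (auto simp: algebra_simps)
  qed
  from this[of "nat (b + 1 - a)"] \<open>a \<le> b\<close> obtain \<sigma> t
    where "alternates ?s' (Suc (nat (b + 1 - a))) \<sigma> t" by auto
  then have "a + int (Suc (nat (b + 1 - a))) \<le> b + 1"
    by (rule spline_variation_diminishing[rotated]) (use c in auto)
  moreover have "int (nat (b + 1 - a)) = b + 1 - a" using \<open>a \<le> b\<close> by simp
  ultimately show False by linarith
qed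

text \<open>By \<open>spline_nonzero_gaps\<close> the spline vanishes on a whole gap, and local
  independence turns this into a block of zero coefficients. The block separates off a smaller
  problem on its left, which yields \<open>c a = 0\<close>; then the range shrinks to
  \<open>a + 1..b\<close>.\<close>

theorem schoenberg_whitney:
  fixes x :: "int \<Rightarrow> real"
  assumes "\<And>l. l \<notin> {a..b} \<Longrightarrow> c l = 0"
    and "\<And>l. l \<in> {a..b} \<Longrightarrow> of_int l < x l \<and> x l < of_int l + real p + 2"
    and "\<And>l. a \<le> l \<Longrightarrow> l < b \<Longrightarrow> x l < x (l + 1)"
    and "\<And>l. l \<in> {a..b} \<Longrightarrow> spline (Suc p) c a b (x l) = 0"
  shows "c l = 0"
  using assms
proof (induction "nat (b + 1 - a)" arbitrary: a b c l rule: less_induct)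
  case less
  note c = less.prems(1) and supp = less.prems(2) and mono = less.prems(3) and zero = less.prems(4)
  let ?s = "spline (Suc p) c a b"
  show ?case
  proof (cases "a \<le> b")
    case False
    then show ?thesis using c by simp
  next
    case True
    \<comment> \<open>The given zeros, extended by the two ends of the support to indices
      \<open>a - 1..b + 1\<close>.\<close>
    define X where "X j = (if j < a then of_int a else if j > b then of_int b + real p + 2 else x j)" for j
    have X_less: "X j < X (j + 1)" if "j \<in> {a - 1..b}" for j
      using that supp[of a] supp[of b] mono[of j] True
      by (cases "j = a - 1"; cases "j = b") (auto simp: X_def)
    have X_zero: "?s (X j) = 0" for j
      by (auto simp: X_def spline_Suc_eq_0 zero)
    obtain j where j: "j \<in> {a - 1..b}" "\<And>u. X j < u \<Longrightarrow> u < X (j + 1) \<Longrightarrow> ?s u = 0"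
      using spline_nonzero_gaps[where c = c and a = a and b = b and X = X and p = p] c True X_zero
      by blast
    \<comment> \<open>The cell of the left end of the gap; the part of the gap inside this cell is
      enough for local independence.\<close>
    define i where "i = \<lfloor>X j\<rfloor>"
    have i: "of_int i \<le> X j" "X j < of_int i + 1" unfolding i_def by linarith+
    have c0: "c l = 0" if "l \<in> {i - int (Suc p)..i}" for l
      by (rule spline_coeffs_eq_0[of a b c i "X j" "min (X (j + 1)) (of_int i + 1)" "Suc p"])
        (use c i X_less[OF j(1)] j(2) that in auto)
    have "of_int a \<le> X j" "X j < of_int b + real p + 2"
      using supp[of j] j(1) True by (auto simp: X_def dest: spec)
    then have ib: "a \<le> i" "i \<le> b + int p + 1"
      unfolding i_def by linarith+
    have "c a = 0"
    proof (cases "i - int (Suc p) \<le> a")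
      case True
      then show ?thesis using c0[of a] ib by simp
    next
      case False
      \<comment> \<open>The last index before the zero block. For \<open>m <= b'\<close> the point
        satisfies \<open>x m < m + p + 2 <= i\<close>, so B-splines beyond the block do not reach it
        and the coefficients \<open>a..b'\<close> solve a problem of their own.\<close>
      define b' where "b' = i - int (Suc p) - 1"
      define c' where "c' l = (if l \<le> b' then c l else 0)" for l
      have b': "a \<le> b'" "b' < b" using False ib by (auto simp: b'_def)
      have "c' a = 0"
      proof (rule less.hyps[where a = a and b = b' and c = c'])
        show "nat (b' + 1 - a) < nat (b + 1 - a)" using b' by simp
        show "c' l = 0" if "l \<notin> {a..b'}" for l using that c b' by (auto simp: c'_def)
        show "of_int l < x l \<and> x l < of_int l + real p + 2" if "l \<in> {a..b'}" for l
          using supp that b' by simp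
        show "x l < x (l + 1)" if "a \<le> l" "l < b'" for l using mono that b' by simp
        show "spline (Suc p) c' a b' (x m) = 0" if m: "m \<in> {a..b'}" for m
        proof -
          have "spline (Suc p) c' a b' (x m)
              = (\<Sum>l=a..b'. c l * causal_bspline (Suc p) (x m - of_int l))"
            unfolding spline_def by (rule sum.cong) (auto simp: c'_def)
          also have "\<dots> = ?s (x m)"
            unfolding spline_def
          proof (rule sum.mono_neutral_left)
            show "\<forall>l\<in>{a..b} - {a..b'}. c l * causal_bspline (Suc p) (x m - of_int l) = 0"
            proof
              fix l assume l: "l \<in> {a..b} - {a..b'}"
              show "c l * causal_bspline (Suc p) (x m - of_int l) = 0"
              proof (cases "l \<le> i")
                case True
                then have "l \<in> {i - int (Suc p)..i}" using l by (auto simp: b'_def)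
                then show ?thesis using c0 by simp
              next
                case False
                have "x m < of_int m + real p + 2" using supp[of m] m b' by simp
                also have "\<dots> \<le> of_int i"
                proof -
                  have "m + int p + 2 \<le> i" using m by (simp add: b'_def)
                  then have "real_of_int (m + int p + 2) \<le> of_int i" by (simp only: of_int_le_iff)
                  then show ?thesis by simp
                qed
                also have "\<dots> < of_int l" using False by simp
                finally show ?thesis by (simp add: causal_bspline_eq_0)
              qed
            qed
          qed (use b' in auto)
          also have "\<dots> = 0" using zero m b' by simp
          finally show ?thesis .
        qed
      qed
      then show ?thesis using b' by (simp add: c'_def)
    qed
    show ?thesis
    proof (rule less.hyps[where a = "a + 1" and b = b and c = c])
      show "c l = 0" if "l \<notin> {a + 1..b}" for l
        using that c \<open>c a = 0\<close> by (cases "l = a") auto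
      show "spline (Suc p) c (a + 1) b (x l) = 0" if "l \<in> {a + 1..b}" for l
      proof -
        have "{a..b} = insert a {a + 1..b}" using True by auto
        then have "spline (Suc p) c (a + 1) b (x l) = ?s (x l)"
          using \<open>c a = 0\<close> by (simp add: spline_def)
        then show ?thesis using zero that by simp
      qed
    qed (use True supp mono in auto)
  qed
qed

section \<open>Solvability of linear systems\<close>

text \<open>Rows are added one at a time. Independence provides a vector \<open>g\<close> that the
  old rows annihilate and the new row does not, and a multiple of \<open>g\<close> corrects the old
  solution.\<close>

lemma solvable_if_rows_independent:
  fixes M :: "'a \<Rightarrow> 'b \<Rightarrow> 'c :: field"
  assumes "finite A" "finite B"
    and "\<And>c. (\<And>k. k \<in> B \<Longrightarrow> (\<Sum>l\<in>A. c l * M l k) = 0) \<Longrightarrow> \<forall>l\<in>A. c l = 0"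
  shows "\<exists>h. \<forall>l\<in>A. (\<Sum>k\<in>B. h k * M l k) = y l"
  using assms(1,3)
proof (induction A arbitrary: y rule: finite_induct)
  case (insert a A)
  have indep: "\<forall>l\<in>A. c l = 0" if "\<And>k. k \<in> B \<Longrightarrow> (\<Sum>l\<in>A. c l * M l k) = 0" for c
  proof -
    have "(\<Sum>l\<in>insert a A. (if l = a then 0 else c l) * M l k) = (\<Sum>l\<in>A. c l * M l k)" for k
      using insert.hyps by (simp, intro sum.cong) auto
    then have "\<forall>l\<in>insert a A. (if l = a then 0 else c l) = 0"
      using that by (intro insert.prems) auto
    with insert.hyps show ?thesis by (metis insertCI)
  qed
  have IH: "\<exists>h. \<forall>l\<in>A. (\<Sum>k\<in>B. h k * M l k) = y l" for y
    by (rule insert.IH) (use indep in auto)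
  have "\<exists>g. (\<forall>l\<in>A. (\<Sum>k\<in>B. g k * M l k) = 0) \<and> (\<Sum>k\<in>B. g k * M a k) \<noteq> 0"
  proof (rule ccontr)
    assume neg: "\<not> ?thesis"
    have "\<forall>l'. \<exists>h. \<forall>l\<in>A. (\<Sum>k\<in>B. h k * M l k) = (if l = l' then 1 else 0)"
    proof
      fix l' show "\<exists>h. \<forall>l\<in>A. (\<Sum>k\<in>B. h k * M l k) = (if l = l' then 1 else 0)"
        using IH[of "\<lambda>l. if l = l' then 1 else 0"] .
    qed
    then obtain h where h: "\<And>l' l. l \<in> A \<Longrightarrow> (\<Sum>k\<in>B. h l' k * M l k) = (if l = l' then 1 else 0)"
      by metis
    define d where "d l = (\<Sum>k\<in>B. h l k * M a k)" for l
    have row: "M a j = (\<Sum>l'\<in>A. M l' j * d l')" if "j \<in> B" for j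
    proof -
      \<comment> \<open>The unit vector at \<open>j\<close> minus a combination of the vectors
        \<open>h l'\<close> biorthogonal to the old rows, so the old rows annihilate it. If the new
        row does too, its entry at \<open>j\<close> is the combination of the old rows with
        coefficients \<open>d\<close>.\<close>
      define g where "g k = (if k = j then 1 else 0) - (\<Sum>l'\<in>A. M l' j * h l' k)" for k
      have g: "(\<Sum>k\<in>B. g k * M l k) = M l j - (\<Sum>l'\<in>A. M l' j * (\<Sum>k\<in>B. h l' k * M l k))" for l
      proof -
        have "(\<Sum>k\<in>B. g k * M l k)
            = (\<Sum>k\<in>B. (if k = j then M l k else 0)) - (\<Sum>k\<in>B. \<Sum>l'\<in>A. M l' j * (h l' k * M l k))"
          by (simp add: g_def left_diff_distrib sum_subtractf sum_distrib_right mult.assoc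
              if_distrib[of "\<lambda>x. x * _"] cong: if_cong)
        then show ?thesis
          using that assms(2) by (simp add: sum.swap[of _ B A] sum_distrib_left)
      qed
      have "(\<Sum>k\<in>B. g k * M l k) = 0" if "l \<in> A" for l
        using that insert.hyps by (simp add: g h if_distrib[of "\<lambda>x. _ * x"] cong: if_cong)
      with neg have "(\<Sum>k\<in>B. g k * M a k) = 0" by blast
      then show ?thesis by (simp add: g d_def)
    qed
    have "\<forall>l\<in>insert a A. (if l = a then -1 else d l) = 0"
    proof (rule insert.prems)
      fix k assume "k \<in> B"
      have "(\<Sum>l\<in>A. (if l = a then -1 else d l) * M l k) = (\<Sum>l\<in>A. M l k * d l)"
        using insert.hyps by (intro sum.cong) auto
      then show "(\<Sum>l\<in>insert a A. (if l = a then -1 else d l) * M l k) = 0"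
        using row[OF \<open>k \<in> B\<close>] insert.hyps by simp
    qed
    then show False by auto
  qed
  then obtain g where g: "\<And>l. l \<in> A \<Longrightarrow> (\<Sum>k\<in>B. g k * M l k) = 0" "(\<Sum>k\<in>B. g k * M a k) \<noteq> 0"
    by blast
  obtain h where h: "\<And>l. l \<in> A \<Longrightarrow> (\<Sum>k\<in>B. h k * M l k) = y l"
    using IH by blast
  define r where "r = (y a - (\<Sum>k\<in>B. h k * M a k)) / (\<Sum>k\<in>B. g k * M a k)"
  have "(\<Sum>k\<in>B. (h k + r * g k) * M l k) = (\<Sum>k\<in>B. h k * M l k) + r * (\<Sum>k\<in>B. g k * M l k)" for l
    by (simp add: distrib_right sum.distrib sum_distrib_left mult.assoc)
  then have "\<forall>l\<in>insert a A. (\<Sum>k\<in>B. (h k + r * g k) * M l k) = y l"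
    using g h by (auto simp: r_def)
  then show ?case by (rule exI[of _ "\<lambda>k. h k + r * g k"])
qed simp

section \<open>Sampling points and the dual sequence\<close>

lemma bspline_causal: "bspline p x = causal_bspline p (x + (real p + 1) / 2)"
  by (simp add: causal_bspline_def)

lemma bspline_Suc_eq_0: "\<bar>x\<bar> \<ge> (real p + 2) / 2 \<Longrightarrow> bspline (Suc p) x = 0"
proof -
  define s where "s = (real p + 2) / 2"
  assume "\<bar>x\<bar> \<ge> (real p + 2) / 2"
  then have "\<bar>x\<bar> \<ge> s" by (simp add: s_def)
  then have "x + s < 0 \<or> x + s = 0 \<or> x + s \<ge> 2 * s" by linarith
  moreover have "2 * s = real (Suc p) + 1" by (simp add: s_def)
  ultimately have "causal_bspline (Suc p) (x + s) = 0"
    using causal_bspline_eq_0[of "x + s" "Suc p"] by (auto simp: causal_bspline_Suc_at_0)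
  moreover have "bspline (Suc p) x = causal_bspline (Suc p) (x + s)"
    by (simp add: s_def bspline_causal algebra_simps del: bspline.simps)
  ultimately show ?thesis by simp
qed

text \<open>A vanishing combination of the rows is a spline that vanishes at all points
  \<open>k / q + H\<close> with \<open>|k| <= K\<close>. It remains to select
  \<open>2 * L + 1\<close> of these points that satisfy the Schoenberg-Whitney condition.\<close>

lemma sampled_rows_independent:
  fixes q K L :: int
  assumes "q > 1" "0 \<le> L" "L \<le> K"
    and L: "real_of_int L < K / q + (real p + 2) / 2" "real_of_int L + 1 \<ge> K / q + (real p + 2) / 2"
    and zero: "\<And>k. k \<in> {-K..K} \<Longrightarrow> (\<Sum>l=-L..L. c l * sampled_bspline (Suc p) q (k - q * l)) = 0"
    and "l \<in> {-L..L}"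
  shows "c l = 0"
proof -
  define H where "H = (real p + 2) / 2"
  have H: "H \<ge> 1" by (simp add: H_def)
  have q: "real_of_int q > 1" using assms by simp
  text \<open>The largest increasing choice of sampling points with \<open>\<kappa> L \<le> K\<close> and \<open>\<kappa> l / q < l + H\<close>.\<close>
  define \<kappa> where "\<kappa> l = min (K - L + l) (\<lceil>q * (l + H)\<rceil> - 1)" for l :: int
  have ceil: "\<lceil>q * (l + H)\<rceil> - 1 < q * (l + H)" "\<lceil>q * (l + H)\<rceil> \<ge> q * (l + H)" for l :: int
    by linarith+
  have qL: "q * L < K + q * H"
    using L(1) q by (simp add: H_def field_simps)
  have upper: "\<kappa> l < q * (l + H)" for l
    using ceil(1)[of l] unfolding \<kappa>_def by linarith
  \<comment> \<open>For the first entry of the minimum, \<open>q * (l - H) < K - L + l\<close> is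
    \<open>qL\<close> at \<open>l = L\<close>; lowering \<open>l\<close> by 1 lowers the left side
    by \<open>q\<close> and the right side only by 1.\<close>
  have lower: "q * (l - H) < \<kappa> l" if "l \<le> L" for l
  proof -
    have "1 * real_of_int (L - l) \<le> q * real_of_int (L - l)"
      using that q by (intro mult_right_mono) auto
    then have "q * (l - H) < K - L + l"
      using qL by (simp add: algebra_simps)
    moreover have "q * (l - H) < \<lceil>q * (l + H)\<rceil> - 1"
    proof -
      have "1 * 1 \<le> q * H" using q H by (intro mult_mono) auto
      then show ?thesis using ceil(2)[of l] unfolding right_diff_distrib distrib_left by linarith
    qed
    ultimately show ?thesis unfolding \<kappa>_def by (simp add: min_def)
  qed
  \<comment> \<open>Both entries of the minimum grow by at least 1 per step, the ceiling because
    \<open>q > 1\<close>.\<close>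
  have mono: "\<kappa> l < \<kappa> (l + 1)" for l
  proof -
    have "\<lceil>q * (l + H)\<rceil> + 1 \<le> \<lceil>q * ((l + 1 :: int) + H)\<rceil>"
      using q by (simp add: ceiling_le_iff algebra_simps) linarith
    then show ?thesis unfolding \<kappa>_def by (simp add: min_def)
  qed
  \<comment> \<open>Here \<open>L <= K\<close> enters: \<open>K - L + l >= K - 2 * L >= - K\<close>.
    The ceiling entry is bounded below through its value at \<open>l = - L\<close>.\<close>
  have range: "\<kappa> l \<in> {-K..K}" if "l \<in> {-L..L}" for l
  proof -
    have "q * (-L + H) \<le> q * (l + H)" using that q by (intro mult_left_mono) auto
    then have "real_of_int (-K) < q * (l + H)" using qL by (simp add: algebra_simps)
    then have "-K < \<lceil>q * (l + H)\<rceil>" using ceil(2)[of l] by linarith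
    then show ?thesis using that assms(3) unfolding \<kappa>_def by auto
  qed
  define c' where "c' l = (if l \<in> {-L..L} then c l else 0)" for l
  have "c' l = 0"
  proof (rule schoenberg_whitney[where a = "-L" and b = L and x = "\<lambda>l. \<kappa> l / q + H" and p = p])
    show "c' l = 0" if "l \<notin> {-L..L}" for l using that by (auto simp: c'_def)
    show "of_int l < \<kappa> l / q + H \<and> \<kappa> l / q + H < of_int l + real p + 2" if "l \<in> {-L..L}" for l
    proof -
      have "\<kappa> l / q < l + H" "l - H < \<kappa> l / q"
        using upper[of l] lower[of l] that q by (auto simp: field_simps)
      then show ?thesis by (auto simp: H_def field_simps)
    qed
    show "\<kappa> l / q + H < \<kappa> (l + 1) / q + H" for l
      using mono[of l] q by (simp add: divide_strict_right_mono)
    show "spline (Suc p) c' (-L) L (\<kappa> l / q + H) = 0" if l: "l \<in> {-L..L}" for l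
    proof -
      have "sampled_bspline (Suc p) q (\<kappa> l - q * m) = causal_bspline (Suc p) (\<kappa> l / q + H - m)" for m
        using q by (simp add: sampled_bspline_def bspline_causal H_def diff_divide_distrib algebra_simps
            del: bspline.simps)
      then have "spline (Suc p) c' (-L) L (\<kappa> l / q + H)
          = (\<Sum>m=-L..L. c m * sampled_bspline (Suc p) q (\<kappa> l - q * m))"
        unfolding spline_def by (intro sum.cong) (auto simp: c'_def)
      then show ?thesis using zero[OF range[OF l]] by simp
    qed
  qed
  with assms show ?thesis by (simp add: c'_def)
qed

text \<open>The assumption \<open>fits\<close> is equivalent to \<open>L <= K\<close> for the
  \<open>L\<close> defined in the proof.\<close>

lemma dual_exists:
  fixes q K :: int
  assumes "q > 1" "K > 0" and fits: "K / q + (real p + 2) / 2 \<le> K + 1"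
  shows "\<exists>h :: int \<Rightarrow> real.
    compact_seq h \<and> has_support h K \<and> dual_to h q (sampled_bspline (Suc p) q)"
proof -
  let ?b = "sampled_bspline (Suc p) q"
  \<comment> \<open>The largest integer strictly below the bound; strictness suffices because the
    B-spline is 0 at the ends of its support.\<close>
  define L where "L = \<lceil>K / q + (real p + 2) / 2\<rceil> - 1"
  have q: "real_of_int q > 1" using assms by simp
  have "K / q > 0" using assms by simp
  then have "K / q + (real p + 2) / 2 > 1"
    by (simp add: add_divide_distrib add_nonneg_pos)
  then have L: "0 \<le> L" "L \<le> K" "real_of_int L < K / q + (real p + 2) / 2"
    "real_of_int L + 1 \<ge> K / q + (real p + 2) / 2"
    using fits unfolding L_def by linarith+
  have "\<exists>g. \<forall>l\<in>{-L..L}. (\<Sum>k=-K..K. g k * ?b (k - q * l)) = (if l = 0 then 1 else 0)"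
    by (rule solvable_if_rows_independent)
      (use sampled_rows_independent[OF assms(1) L] in blast)+
  then obtain g where g: "\<And>l. l \<in> {-L..L} \<Longrightarrow>
      (\<Sum>k=-K..K. g k * ?b (k - q * l)) = (if l = 0 then 1 else 0)"
    by blast
  define h where "h k = (if k \<in> {-K..K} then g k else 0)" for k
  have supp: "h k = 0" if "k \<notin> {-K..K}" for k using that by (auto simp: h_def)
  have sum: "(\<Sum>k=-K..K. h k * ?b (k - q * l)) = (if l = 0 then 1 else 0)" for l
  proof (cases "l \<in> {-L..L}")
    case True
    then show ?thesis using g by (simp add: h_def)
  next
    case False
    \<comment> \<open>For \<open>|l| > L\<close> the shifted B-spline misses all samples in
      \<open>-K..K\<close>, so this equation reads \<open>0 = 0\<close>.\<close>
    have "?b (k - q * l) = 0" if "k \<in> {-K..K}" for k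
    proof -
      have "\<bar>of_int l :: real\<bar> \<ge> L + 1" using False L(1) by (auto simp: abs_if)
      moreover have "\<bar>k / q\<bar> \<le> K / q" using that q by (auto simp: abs_le_iff field_simps)
      ultimately have "\<bar>k / q - l\<bar> \<ge> (real p + 2) / 2" using L(4) by linarith
      moreover have "of_int (k - q * l) / of_int q = k / q - real_of_int l"
        using q by (simp add: field_simps)
      ultimately show ?thesis by (simp add: sampled_bspline_def bspline_Suc_eq_0 del: bspline.simps)
    qed
    then show ?thesis using False L(1) by auto
  qed
  have "dual_to h q ?b"
    unfolding dual_to_def
  proof
    fix l
    have "((\<lambda>k. h k * ?b (k - q * l)) has_sum (\<Sum>k=-K..K. h k * ?b (k - q * l))) {-K..K}"
      by (rule has_sum_finite) simp
    then have "((\<lambda>k. h k * ?b (k - q * l)) has_sum (if l = 0 then 1 else 0)) {-K..K}"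
      by (simp only: sum)
    then show "((\<lambda>k. h k * ?b (k - q * l)) has_sum (if l = 0 then 1 else 0)) UNIV"
      by (rule has_sum_cong_neutral[THEN iffD1, rotated -1]) (auto simp: supp)
  qed
  moreover have "compact_seq h"
    unfolding compact_seq_def by (rule finite_subset[of _ "{-K..K}"]) (auto intro: ccontr simp: h_def)
  moreover have "has_support h K"
    unfolding has_support_def by (auto simp: h_def abs_if split: if_splits)
  ultimately show ?thesis by blast
qed

theorem theorem2:
  fixes p :: nat and q K :: int
  assumes "p > 0" and "q > 1" and "K > 0"
    and "odd p \<Longrightarrow>
      real_of_int K > (real p + 1) / 2 * (real_of_int q / (real_of_int q - 1))
                        - (real_of_int q + 1) / (real_of_int q - 1)"
    and "even p \<Longrightarrow>
      K > \<lceil>(real p + 1) / 2 * (real_of_int q / (real_of_int q - 1))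
             - (real_of_int q + 1) / (real_of_int q - 1)\<rceil>"
  shows "\<exists>h :: int \<Rightarrow> real.
    compact_seq h \<and> has_support h K \<and> dual_to h q (sampled_bspline p q)"
proof -
  obtain r where r: "p = Suc r" using \<open>p > 0\<close> by (cases p) auto
  have q: "real_of_int q > 1" using assms by simp
  let ?X = "(real p + 1) / 2 * (real_of_int q / (real_of_int q - 1))
    - (real_of_int q + 1) / (real_of_int q - 1)"
  have X: "?X * (q - 1) = (real p + 1) / 2 * q - (real_of_int q + 1)"
  proof -
    have "(A * (B / D) - C / D) * D = A * B - C" if "D \<noteq> 0" for A B C D :: real
      using that by (simp add: left_diff_distrib)
    from this[of "real_of_int q - 1" "(real p + 1) / 2" "real_of_int q" "real_of_int q + 1"]
    show ?thesis using q by (simp only: of_int_diff of_int_1)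
  qed
  \<comment> \<open>This is the condition \<open>fits\<close> multiplied by \<open>q\<close>. By
    \<open>X\<close> the hypothesis on \<open>K\<close> falls short of it by 1, and the two parities
    recover this 1 differently.\<close>
  have "(real p + 1) / 2 * q - q \<le> real_of_int K * (q - 1)"
  proof (cases "odd p")
    case True
    then obtain m where m: "p = 2 * m + 1" by (elim oddE)
    have "?X * (q - 1) < real_of_int K * (q - 1)"
      using assms(4)[OF True] q by (intro mult_strict_right_mono) auto
    \<comment> \<open>For odd \<open>p\<close> both sides are integers, so the strict inequality
      gains the missing 1.\<close>
    then have "real_of_int (m * q - 1) < real_of_int (K * (q - 1))"
      unfolding X by (simp add: m field_simps)
    then have "m * q \<le> K * (q - 1)" by (simp only: of_int_less_iff)
    then have "real_of_int (m * q) \<le> real_of_int (K * (q - 1))" by (simp only: of_int_le_iff)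
    then show ?thesis by (simp add: m field_simps)
  next
    case False
    \<comment> \<open>For even \<open>p\<close> the ceiling gives a full unit over
      \<open>?X\<close>, which becomes \<open>q - 1 >= 1\<close> after multiplication.\<close>
    then have "?X + 1 \<le> real_of_int K" using assms(5) by linarith
    then have "(?X + 1) * (q - 1) \<le> real_of_int K * (q - 1)"
      using q by (intro mult_right_mono) auto
    moreover have "real_of_int q \<ge> 2" using assms(2) by simp
    ultimately show ?thesis unfolding distrib_right[of ?X 1] X by simp
  qed
  then have "K / q + (real r + 2) / 2 \<le> K + 1"
    using q by (simp add: r field_simps)
  then show ?thesis
    unfolding r using dual_exists assms by blast
qed

end
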